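(* Let $M$ be a $5\times 5$ dissimilarity matrix. The following are equivalent: (1) $M$ has star tree rank at most $2$; (2) the deficiency graph of $M$ is $2$-colorable; (3) there is a permutation $\sigma$ of $[5]$, writing $a_i=\sigma(i)$, such that the two $5$-cycles $a_1a_2a_3a_4a_5$ and $a_1a_3a_2a_4a_5$ (which differ by a transposition) both attain the minimum of $w(C)$ over all $12$ cycles $C$ on vertex set $[5]$, and $M_{a_1a_4}+M_{a_2a_3}\le M_{a_1a_2}+M_{a_3a_4}=M_{a_1a_3}+M_{a_2a_4}$.
   Context: A $5\times5$ dissimilarity matrix is a function from 2-element subsets of $[5]$ to $\mathbb{R}$. A star tree matrix is one of the form $(v_i+v_j)_{i\ne j}$, $v\in\mathbb{R}^5$; the star tree rank of $M$ is the least $r$ such that $M$ is the entrywise minimum of $r$ star tree matrices. The deficiency graph of $M$ has vertex set the 2-element subsets of $[5]$, with an edge between $\{i,j\}$ and $\{k,l\}$ ($i,j,k,l$ distinct) whenever $M_{ij}+M_{kl}<M_{ik}+M_{jl}$ or $M_{ij}+M_{kl}<M_{il}+M_{jk}$ (it arises from the tropical basis $x_{ij}x_{kl}\oplus x_{ik}x_{jl}$). For a Hamiltonian cycle $C=b_1b_2b_3b_4b_5$ on $[5]$, $w(C)=M_{b_1b_2}+M_{b_2b_3}+M_{b_3b_4}+M_{b_4b_5}+M_{b_5b_1}$; these are the values of the 12 terms of the tropicalized pentad. *)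

theory Defs
  imports Complex_Main "HOL-Combinatorics.Permutations"
begin

definition pairs5 :: "nat set set" where
  "pairs5 = {e. e \<subseteq> {1..5} \<and> card e = 2}"

text \<open>A \<open>5 \<times> 5\<close> dissimilarity matrix is a function \<open>M :: nat set \<Rightarrow> real\<close>, of which only the
  values on \<^const>\<open>pairs5\<close> are ever used; the entry \<open>M\<^sub>i\<^sub>j\<close> is written \<open>M {i, j}\<close>.\<close>

definition star_tree_matrix :: "(nat set \<Rightarrow> real) \<Rightarrow> bool" where
  "star_tree_matrix T \<longleftrightarrow>
     (\<exists>v :: nat \<Rightarrow> real. \<forall>i\<in>{1..5}. \<forall>j\<in>{1..5}. i \<noteq> j \<longrightarrow> T {i, j} = v i + v j)"

definition is_min_of_star_trees :: "(nat set \<Rightarrow> real) \<Rightarrow> nat \<Rightarrow> bool" where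
  "is_min_of_star_trees M r \<longleftrightarrow> 1 \<le> r \<and>
     (\<exists>T :: nat \<Rightarrow> nat set \<Rightarrow> real. (\<forall>k<r. star_tree_matrix (T k)) \<and>
        (\<forall>e\<in>pairs5. M e = Min ((\<lambda>k. T k e) ` {..<r})))"

text \<open>The least \<open>r\<close> always exists: see \<open>ex_min_of_star_trees\<close> below.\<close>

definition star_tree_rank :: "(nat set \<Rightarrow> real) \<Rightarrow> nat" where
  "star_tree_rank M = (LEAST r. is_min_of_star_trees M r)"

text \<open>A graph is a pair of a vertex set and a set of two-element sets of vertices.\<close>

definition colorable :: "nat \<Rightarrow> 'a set \<times> 'a set set \<Rightarrow> bool" where
  "colorable k G \<longleftrightarrow>
     (\<exists>c :: 'a \<Rightarrow> nat. (\<forall>x\<in>fst G. c x < k) \<and> (\<forall>x y. {x, y} \<in> snd G \<longrightarrow> c x \<noteq> c y))"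

definition deficiency_graph :: "(nat set \<Rightarrow> real) \<Rightarrow> nat set set \<times> nat set set set" where
  "deficiency_graph M =
     (pairs5,
      {{{i, j}, {k, l}} | i j k l. {i, j, k, l} \<subseteq> {1..5} \<and> distinct [i, j, k, l] \<and>
         (M {i, j} + M {k, l} < M {i, k} + M {j, l} \<or>
          M {i, j} + M {k, l} < M {i, l} + M {j, k})})"

text \<open>A 5-cycle is identified with its set of edges, so that the ten sequences obtained from
  \<open>b\<^sub>1b\<^sub>2b\<^sub>3b\<^sub>4b\<^sub>5\<close> by rotation and reflection denote the same cycle.\<close>

definition cycle5 :: "nat \<Rightarrow> nat \<Rightarrow> nat \<Rightarrow> nat \<Rightarrow> nat \<Rightarrow> nat set set" where
  "cycle5 b1 b2 b3 b4 b5 = {{b1, b2}, {b2, b3}, {b3, b4}, {b4, b5}, {b5, b1}}"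

definition hamiltonian_cycles :: "nat set set set" where
  "hamiltonian_cycles =
     {cycle5 b1 b2 b3 b4 b5 | b1 b2 b3 b4 b5.
        distinct [b1, b2, b3, b4, b5] \<and> {b1, b2, b3, b4, b5} = {1..5}}"

definition cycle_weight :: "(nat set \<Rightarrow> real) \<Rightarrow> nat set set \<Rightarrow> real" where
  "cycle_weight M C = (\<Sum>e\<in>C. M e)"

definition attains_min_weight :: "(nat set \<Rightarrow> real) \<Rightarrow> nat set set \<Rightarrow> bool" where
  "attains_min_weight M C \<longleftrightarrow>
     is_arg_min (cycle_weight M) (\<lambda>C'. C' \<in> hamiltonian_cycles) C"

lemma cycle_weight_cycle5:
  assumes "distinct [b1, b2, b3, b4, b5]"
  shows "cycle_weight M (cycle5 b1 b2 b3 b4 b5) =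
    M {b1, b2} + M {b2, b3} + M {b3, b4} + M {b4, b5} + M {b5, b1}"
proof -
  have "distinct [{b1, b2}, {b2, b3}, {b3, b4}, {b4, b5}, {b5, b1}]"
    using assms by (auto simp: doubleton_eq_iff)
  then show ?thesis
    unfolding cycle_weight_def cycle5_def by (simp add: add.assoc)
qed

lemma ex_min_of_star_trees: "\<exists>r. is_min_of_star_trees M r"
proof -
  have fin: "finite pairs5"
    unfolding pairs5_def by (rule finite_subset[of _ "Pow {1..5}"]) auto
  obtain n :: nat and p where p: "p ` {..<n} = pairs5"
    using fin finite_imp_nat_seg_image_inj_on[OF fin] by (auto simp: lessThan_def)
  have "{1, 2} \<in> pairs5" by (auto simp: pairs5_def)
  then have n: "1 \<le> n" using p by (cases n) auto
  define B where "B = (\<Sum>e\<in>pairs5. \<bar>M e\<bar>)"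
  have B: "\<bar>M e\<bar> \<le> B" if "e \<in> pairs5" for e
    unfolding B_def using fin that by (intro member_le_sum) auto
  define v where "v e i = (if i \<in> e then M e / 2 else 2 * B)" for e :: "nat set" and i
  define T where "T k d = (\<Sum>i\<in>d. v (p k) i)" for k and d :: "nat set"
  have star: "star_tree_matrix (T k)" for k
    unfolding star_tree_matrix_def T_def by (rule exI[of _ "v (p k)"]) auto
  have eq: "T k (p k) = M (p k)" if "k < n" for k
  proof -
    have "p k \<in> pairs5" using that p by auto
    then have "card (p k) = 2" by (simp add: pairs5_def)
    then show ?thesis by (simp add: T_def v_def)
  qed
  have ge: "M d \<le> T k d" if k: "k < n" and d: "d \<in> pairs5" for k d
  proof -
    have pk: "p k \<in> pairs5" using k p by auto
    obtain i j where ij: "d = {i, j}" "i \<noteq> j"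
      using d by (auto simp: pairs5_def card_2_iff)
    obtain a b where ab: "p k = {a, b}" "a \<noteq> b"
      using pk by (auto simp: pairs5_def card_2_iff)
    show ?thesis
    proof (cases "d = p k")
      case True
      then show ?thesis using eq[OF k] by simp
    next
      case False
      then have "\<not> (i \<in> p k \<and> j \<in> p k)" using ij ab by auto
      then show ?thesis
        using B[OF d] B[OF pk] ij by (auto simp: T_def v_def)
    qed
  qed
  have "M e = Min ((\<lambda>k. T k e) ` {..<n})" if e: "e \<in> pairs5" for e
  proof -
    obtain k where "k < n" "e = p k" using e p by auto
    then show ?thesis
      using eq ge e by (intro Min_eqI[symmetric]) (auto intro: rev_image_eqI)
  qed
  then show ?thesis
    unfolding is_min_of_star_trees_def using n star by blast
qed

end

theory Submission
  imports Defs
begin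

text \<open>(1) implies (2): colour each pair by a star tree attaining the minimum there; two disjoint
  pairs with the same colour cannot be deficient, since a star tree gives the same value to all
  three matchings of a 4-set.

  (2) implies (3): take a minimal Hamiltonian cycle. Its five edges, ordered by disjointness, form a
  5-cycle \<open>C\<close> in the Petersen graph. As an odd cycle is not 2-colourable, some edge of \<open>C\<close> is
  missing from the deficiency graph, which means that a matching of two cycle edges is maximal in
  its 4-set. By minimality it is at most the crossing matching, so both are equal, and replacing one
  by the other yields a second minimal cycle.

  (3) implies (1): one star tree is fitted to the entries \<open>12, 13, 23, 24, 34\<close>, the other to
  \<open>14, 15, 45, 25, 35\<close>. That they dominate \<open>M\<close> elsewhere follows from the 2-opt inequalities of the
  two minimal cycles.\<close>

section \<open>Hamiltonian cycles and their minimal weight\<close>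

definition enumerates5 :: "nat list \<Rightarrow> bool" where
  "enumerates5 b \<longleftrightarrow> distinct b \<and> set b = {1..5}"

lemma enumerates5_mset: "enumerates5 b \<Longrightarrow> mset b' = mset b \<Longrightarrow> enumerates5 b'"
  unfolding enumerates5_def using mset_eq_imp_distinct_iff mset_eq_setD by metis

lemma enumerates5_subset: "enumerates5 b \<Longrightarrow> set b' \<subseteq> set b \<Longrightarrow> set b' \<subseteq> {1..5}"
  by (simp add: enumerates5_def)

lemma enumerates5_distinct: "enumerates5 b \<Longrightarrow> distinct b"
  by (simp add: enumerates5_def)

lemma doubleton_in_pairs5: "i \<in> {1..5} \<Longrightarrow> j \<in> {1..5} \<Longrightarrow> i \<noteq> j \<Longrightarrow> {i, j} \<in> pairs5"
  by (simp add: pairs5_def)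

lemma cycle5_rotate: "cycle5 b2 b3 b4 b5 b1 = cycle5 b1 b2 b3 b4 b5"
  by (auto simp: cycle5_def)

lemma hamiltonian_cycles_iff:
  "C \<in> hamiltonian_cycles \<longleftrightarrow>
    (\<exists>b1 b2 b3 b4 b5. C = cycle5 b1 b2 b3 b4 b5 \<and> enumerates5 [b1, b2, b3, b4, b5])"
  by (simp add: hamiltonian_cycles_def enumerates5_def)

lemma ex_attains_min_weight: "\<exists>C\<in>hamiltonian_cycles. attains_min_weight M C"
proof -
  have "cycle5 b1 b2 b3 b4 b5 \<subseteq> Pow {b1, b2, b3, b4, b5}" for b1 b2 b3 b4 b5
    by (simp add: cycle5_def)
  then have "hamiltonian_cycles \<subseteq> Pow (Pow {1..5})"
    unfolding hamiltonian_cycles_def by blast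
  then have "finite hamiltonian_cycles"
    by (rule finite_subset) simp
  moreover have "cycle5 1 2 3 4 5 \<in> hamiltonian_cycles"
    unfolding hamiltonian_cycles_iff enumerates5_def
    by (intro exI[of _ 1] exI[of _ 2] exI[of _ 3] exI[of _ 4] exI[of _ 5]) auto
  ultimately obtain C where "is_arg_min (cycle_weight M) (\<lambda>C. C \<in> hamiltonian_cycles) C"
    using ex_is_arg_min_if_finite[of hamiltonian_cycles "cycle_weight M"] by blast
  then show ?thesis
    by (auto simp: attains_min_weight_def is_arg_min_def)
qed

lemma attains_min_weight_le:
  assumes "attains_min_weight M C" "D \<in> hamiltonian_cycles"
  shows "cycle_weight M C \<le> cycle_weight M D"
  using assms by (auto simp: attains_min_weight_def is_arg_min_linorder)

lemma attains_min_weight_eq: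
  assumes "attains_min_weight M C" "D \<in> hamiltonian_cycles"
    and "cycle_weight M D = cycle_weight M C"
  shows "attains_min_weight M D"
  using assms by (auto simp: attains_min_weight_def is_arg_min_def)

text \<open>A cycle as an edge set forgets its vertex sequence; keeping the sequence lets one local
  inequality be moved around the cycle by rotation.\<close>

definition minimal_cycle :: "(nat set \<Rightarrow> real) \<Rightarrow> nat \<Rightarrow> nat \<Rightarrow> nat \<Rightarrow> nat \<Rightarrow> nat \<Rightarrow> bool" where
  "minimal_cycle M b1 b2 b3 b4 b5 \<longleftrightarrow>
     attains_min_weight M (cycle5 b1 b2 b3 b4 b5) \<and> enumerates5 [b1, b2, b3, b4, b5]"

lemma minimal_cycle_rotate:
  assumes "minimal_cycle M b1 b2 b3 b4 b5"
  shows "minimal_cycle M b2 b3 b4 b5 b1"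
  using assms enumerates5_mset[of "[b1, b2, b3, b4, b5]" "[b2, b3, b4, b5, b1]"]
    cycle5_rotate[of b2 b3 b4 b5 b1]
  by (simp add: minimal_cycle_def)

text \<open>Swapping \<open>b2\<close> and \<open>b3\<close> keeps the edges \<open>b2b3\<close>,
  \<open>b4b5\<close>, \<open>b5b1\<close>, so comparing the two cycle weights leaves exactly this
  inequality.\<close>

lemma two_opt:
  assumes "minimal_cycle M b1 b2 b3 b4 b5"
  shows "M {b1, b2} + M {b3, b4} \<le> M {b1, b3} + M {b2, b4}"
proof -
  have min: "attains_min_weight M (cycle5 b1 b2 b3 b4 b5)" and b: "enumerates5 [b1, b2, b3, b4, b5]"
    using assms by (simp_all add: minimal_cycle_def)
  have b': "enumerates5 [b1, b3, b2, b4, b5]"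
    using b by (rule enumerates5_mset) simp
  then have "cycle5 b1 b3 b2 b4 b5 \<in> hamiltonian_cycles"
    unfolding hamiltonian_cycles_iff by blast
  with min have "cycle_weight M (cycle5 b1 b2 b3 b4 b5) \<le> cycle_weight M (cycle5 b1 b3 b2 b4 b5)"
    by (rule attains_min_weight_le)
  moreover note enumerates5_distinct[OF b] enumerates5_distinct[OF b']
  ultimately show ?thesis
    by (simp add: cycle_weight_cycle5 insert_commute)
qed

section \<open>From star trees to colourings\<close>

lemma fst_deficiency_graph: "fst (deficiency_graph M) = pairs5"
  by (simp add: deficiency_graph_def)

lemma is_min_of_star_trees_imp_colorable:
  assumes "is_min_of_star_trees M r"
  shows "colorable r (deficiency_graph M)"
proof -
  obtain T where r: "1 \<le> r" and star: "\<And>k. k < r \<Longrightarrow> star_tree_matrix (T k)"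
    and min: "\<And>e. e \<in> pairs5 \<Longrightarrow> M e = Min ((\<lambda>k. T k e) ` {..<r})"
    using assms by (auto simp: is_min_of_star_trees_def)
  have le: "M e \<le> T k e" if "e \<in> pairs5" "k < r" for e k
    using min[OF that(1)] that(2) by simp
  have "\<exists>k<r. T k e = M e" if "e \<in> pairs5" for e
  proof -
    have "Min ((\<lambda>k. T k e) ` {..<r}) \<in> (\<lambda>k. T k e) ` {..<r}"
      using r by (intro Min_in) (auto simp: lessThan_empty_iff)
    then show ?thesis
      using min[OF that] by auto
  qed
  then obtain c where c: "\<And>e. e \<in> pairs5 \<Longrightarrow> c e < r"
    and T_c: "\<And>e. e \<in> pairs5 \<Longrightarrow> T (c e) e = M e"
    by metis
  have neq: "c {i, j} \<noteq> c {k, l}"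
    if ijkl: "{i, j, k, l} \<subseteq> {1..5}" "distinct [i, j, k, l]"
      and def: "M {i, j} + M {k, l} < M {i, k} + M {j, l} \<or>
        M {i, j} + M {k, l} < M {i, l} + M {j, k}" for i j k l
  proof
    assume eq: "c {i, j} = c {k, l}"
    define t where "t = c {i, j}"
    have p: "{i, j} \<in> pairs5" "{k, l} \<in> pairs5" "{i, k} \<in> pairs5" "{j, l} \<in> pairs5"
      "{i, l} \<in> pairs5" "{j, k} \<in> pairs5"
      using ijkl by (auto intro!: doubleton_in_pairs5)
    have t: "t < r" using c p(1) by (simp add: t_def)
    obtain v where v: "\<And>i j. i \<in> {1..5} \<Longrightarrow> j \<in> {1..5} \<Longrightarrow> i \<noteq> j \<Longrightarrow> T t {i, j} = v i + v j"
      using star[OF t] unfolding star_tree_matrix_def by blast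
    have "T t {i, j} = M {i, j}" "T t {k, l} = M {k, l}"
      using T_c[OF p(1)] T_c[OF p(2)] eq by (simp_all add: t_def)
    moreover have "T t {i, j} = v i + v j" "T t {k, l} = v k + v l" "T t {i, k} = v i + v k"
      "T t {j, l} = v j + v l" "T t {i, l} = v i + v l" "T t {j, k} = v j + v k"
      using ijkl by (auto intro!: v)
    \<comment> \<open>Tree \<open>t\<close> is exact on \<open>ij\<close> and \<open>kl\<close> and
      dominates \<open>M\<close> on the other four pairs, so each other matching has
      \<open>M\<close>-value at most \<open>M {i, j} + M {k, l}\<close>.\<close>
    ultimately show False
      using def le[OF p(3) t] le[OF p(4) t] le[OF p(5) t] le[OF p(6) t] by auto
  qed
  have "c x \<noteq> c y" if xy: "{x, y} \<in> snd (deficiency_graph M)" for x y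
  proof -
    obtain i j k l where "{x, y} = {{i, j}, {k, l}}"
      and ijkl: "{i, j, k, l} \<subseteq> {1..5}" "distinct [i, j, k, l]"
      "M {i, j} + M {k, l} < M {i, k} + M {j, l} \<or> M {i, j} + M {k, l} < M {i, l} + M {j, k}"
      using xy unfolding deficiency_graph_def snd_conv mem_Collect_eq by (elim exE conjE)
    then have "x = {i, j} \<and> y = {k, l} \<or> x = {k, l} \<and> y = {i, j}"
      by (simp add: doubleton_eq_iff)
    with neq[OF ijkl] show ?thesis by metis
  qed
  then show ?thesis
    unfolding colorable_def fst_deficiency_graph using c by blast
qed

lemma colorable_mono: "colorable k G \<Longrightarrow> k \<le> m \<Longrightarrow> colorable m G"
  unfolding colorable_def by (meson order_less_le_trans)

section \<open>From colourings to two tied minimal cycles\<close>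

definition tied_minimal_cycles :: "(nat set \<Rightarrow> real) \<Rightarrow> nat \<Rightarrow> nat \<Rightarrow> nat \<Rightarrow> nat \<Rightarrow> nat \<Rightarrow> bool" where
  "tied_minimal_cycles M a1 a2 a3 a4 a5 \<longleftrightarrow> enumerates5 [a1, a2, a3, a4, a5] \<and>
     attains_min_weight M (cycle5 a1 a2 a3 a4 a5) \<and>
     attains_min_weight M (cycle5 a1 a3 a2 a4 a5) \<and>
     M {a1, a4} + M {a2, a3} \<le> M {a1, a2} + M {a3, a4} \<and>
     M {a1, a2} + M {a3, a4} = M {a1, a3} + M {a2, a4}"

text \<open>Translates the permutation of the theorem into five named vertices, the form used by the
  cycle arguments.\<close>

lemma ex_permutes_iff_ex_enumerates5:
  "(\<exists>a. a permutes {1..5} \<and> P (a 1) (a 2) (a 3) (a 4) (a 5)) \<longleftrightarrow>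
   (\<exists>a1 a2 a3 a4 a5. enumerates5 [a1, a2, a3, a4, a5] \<and> P a1 a2 a3 a4 a5)"
  (is "?L \<longleftrightarrow> ?R")
proof
  have five: "{1..5::nat} = {1, 2, 3, 4, 5}" by auto
  {
    assume ?L
    then obtain a where a: "a permutes {1..5}" and P: "P (a 1) (a 2) (a 3) (a 4) (a 5)"
      by blast
    have "inj a" using a by (rule permutes_inj)
    then have "distinct [a 1, a 2, a 3, a 4, a 5]"
      by (simp add: inj_eq)
    moreover have "set [a 1, a 2, a 3, a 4, a 5] = {1..5}"
      using permutes_image[OF a] unfolding five by simp
    ultimately show ?R
      using P unfolding enumerates5_def by blast
  next
    assume ?R
    then obtain a1 a2 a3 a4 a5 where b: "enumerates5 [a1, a2, a3, a4, a5]"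
      and P: "P a1 a2 a3 a4 a5"
      by blast
    define a where "a = id(1 := a1, 2 := a2, 3 := a3, 4 := a4, 5 := a5)"
    have vals: "a 1 = a1" "a 2 = a2" "a 3 = a3" "a 4 = a4" "a 5 = a5"
      by (simp_all add: a_def)
    have "a ` {1, 2, 3, 4, 5} = set [a1, a2, a3, a4, a5]"
      by (simp only: image_insert image_empty vals list.set)
    then have "a ` {1..5} = {1..5}"
      using b unfolding enumerates5_def five by simp
    \<comment> \<open>A map of a finite set onto itself is injective.\<close>
    then have "bij_betw a {1..5} {1..5}"
      by (simp add: bij_betw_def eq_card_imp_inj_on)
    moreover have "a x = x" if "x \<notin> {1..5}" for x
      using that by (auto simp: a_def)
    ultimately have "a permutes {1..5}"
      by (rule bij_imp_permutes)
    with P vals show ?L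
      by (intro exI[of _ a]) simp
  }
qed

lemma tied_minimal_cyclesI:
  assumes cyc: "minimal_cycle M b1 b2 b3 b4 b5"
    and ge: "{{b1, b2}, {b3, b4}} \<notin> snd (deficiency_graph M)"
  shows "tied_minimal_cycles M b1 b2 b3 b4 b5"
proof -
  have min: "attains_min_weight M (cycle5 b1 b2 b3 b4 b5)" and b: "enumerates5 [b1, b2, b3, b4, b5]"
    using cyc by (simp_all add: minimal_cycle_def)
  have b': "enumerates5 [b1, b3, b2, b4, b5]"
    using b by (rule enumerates5_mset) simp
  note d = enumerates5_distinct[OF b] enumerates5_distinct[OF b']
  have sub: "{b1, b2, b3, b4} \<subseteq> {1..5}" "distinct [b1, b2, b3, b4]"
    using enumerates5_subset[OF b, of "[b1, b2, b3, b4]"] d by auto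
  have "\<not> (M {b1, b2} + M {b3, b4} < M {b1, b3} + M {b2, b4} \<or>
      M {b1, b2} + M {b3, b4} < M {b1, b4} + M {b2, b3})"
    using ge sub unfolding deficiency_graph_def snd_conv by blast
  \<comment> \<open>The non-edge bounds both other matchings from above; \<open>two_opt\<close>
    reverses the comparison with the crossing one.\<close>
  then have le: "M {b1, b4} + M {b2, b3} \<le> M {b1, b2} + M {b3, b4}"
    and eq: "M {b1, b2} + M {b3, b4} = M {b1, b3} + M {b2, b4}"
    using two_opt[OF cyc] by auto
  have "cycle_weight M (cycle5 b1 b3 b2 b4 b5) = cycle_weight M (cycle5 b1 b2 b3 b4 b5)"
    using d eq by (simp add: cycle_weight_cycle5 insert_commute)
  moreover have "cycle5 b1 b3 b2 b4 b5 \<in> hamiltonian_cycles"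
    using b' unfolding hamiltonian_cycles_iff by blast
  ultimately have "attains_min_weight M (cycle5 b1 b3 b2 b4 b5)"
    using attains_min_weight_eq[OF min] by blast
  with min b le eq show ?thesis
    by (simp add: tied_minimal_cycles_def)
qed

lemma colorable_imp_tied_minimal_cycles:
  assumes "colorable 2 (deficiency_graph M)"
  shows "\<exists>a1 a2 a3 a4 a5. tied_minimal_cycles M a1 a2 a3 a4 a5"
proof (rule ccontr)
  assume none: "\<not> ?thesis"
  obtain c :: "nat set \<Rightarrow> nat" where c2: "\<And>x. x \<in> pairs5 \<Longrightarrow> c x < 2"
    and c: "\<And>x y. {x, y} \<in> snd (deficiency_graph M) \<Longrightarrow> c x \<noteq> c y"
    using assms unfolding colorable_def fst_deficiency_graph by blast
  obtain b1 b2 b3 b4 b5 where cyc: "minimal_cycle M b1 b2 b3 b4 b5"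
    using ex_attains_min_weight[of M] unfolding minimal_cycle_def Bex_def hamiltonian_cycles_iff
    by blast
  then have b: "enumerates5 [b1, b2, b3, b4, b5]"
    by (simp add: minimal_cycle_def)
  have neq: "c {b1, b2} \<noteq> c {b3, b4}" if "minimal_cycle M b1 b2 b3 b4 b5" for b1 b2 b3 b4 b5
    using tied_minimal_cyclesI[OF that] none c by blast
  note cyc2 = minimal_cycle_rotate[OF cyc]
  note cyc3 = minimal_cycle_rotate[OF cyc2]
  note cyc4 = minimal_cycle_rotate[OF cyc3]
  note cyc5 = minimal_cycle_rotate[OF cyc4]
  \<comment> \<open>These inequalities link the edges in the cyclic order \<open>b1b2\<close>,
    \<open>b3b4\<close>, \<open>b5b1\<close>, \<open>b2b3\<close>, \<open>b4b5\<close>: an odd cycle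
    with only two colours available.\<close>
  note neq[OF cyc] neq[OF cyc2] neq[OF cyc3] neq[OF cyc4] neq[OF cyc5]
  moreover have "c {b1, b2} < 2" "c {b2, b3} < 2" "c {b3, b4} < 2" "c {b4, b5} < 2" "c {b5, b1} < 2"
    using enumerates5_distinct[OF b] enumerates5_subset[OF b, OF subset_refl]
    by (auto intro!: c2 doubleton_in_pairs5)
  ultimately show False by linarith
qed

section \<open>From two tied minimal cycles to two star trees\<close>

lemma is_min_of_star_trees_2I:
  assumes "\<And>i j. i \<in> {1..5} \<Longrightarrow> j \<in> {1..5} \<Longrightarrow> i \<noteq> j \<Longrightarrow> M {i, j} = min (u i + u j) (v i + v j)"
  shows "is_min_of_star_trees M 2"
proof -
  \<comment> \<open>Summing over the pair makes the entry independent of the order of its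
    endpoints.\<close>
  define T where "T k e = (\<Sum>i\<in>e. if k = 0 then u i else v i)" for k :: nat and e :: "nat set"
  have "star_tree_matrix (T k)" for k
    unfolding star_tree_matrix_def T_def
    by (rule exI[of _ "\<lambda>i. if k = 0 then u i else v i"]) auto
  moreover have "M e = Min ((\<lambda>k. T k e) ` {..<2})" if e: "e \<in> pairs5" for e
  proof -
    obtain i j where "e = {i, j}" "i \<noteq> j" "i \<in> {1..5}" "j \<in> {1..5}"
      using e by (auto simp: pairs5_def card_2_iff)
    moreover have "{..<2} = {0, 1::nat}" by auto
    ultimately show ?thesis
      using assms by (simp add: T_def)
  qed
  ultimately show ?thesis
    unfolding is_min_of_star_trees_def by (intro conjI exI[of _ T] ballI allI impI) simp_all
qed

lemma tied_minimal_cycles_imp_is_min_of_star_trees: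
  assumes "tied_minimal_cycles M a1 a2 a3 a4 a5"
  shows "is_min_of_star_trees M 2"
proof -
  have a: "enumerates5 [a1, a2, a3, a4, a5]"
    and min1: "attains_min_weight M (cycle5 a1 a2 a3 a4 a5)"
    and min2: "attains_min_weight M (cycle5 a1 a3 a2 a4 a5)"
    and le: "M {a1, a4} + M {a2, a3} \<le> M {a1, a2} + M {a3, a4}"
    and eq: "M {a1, a2} + M {a3, a4} = M {a1, a3} + M {a2, a4}"
    using assms by (simp_all add: tied_minimal_cycles_def)
  have "minimal_cycle M a1 a2 a3 a4 a5"
    using a min1 by (simp add: minimal_cycle_def)
  note c3 = this[THEN minimal_cycle_rotate, THEN minimal_cycle_rotate]
  note c4 = c3[THEN minimal_cycle_rotate]
  have "minimal_cycle M a1 a3 a2 a4 a5"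
    using enumerates5_mset[OF a, of "[a1, a3, a2, a4, a5]"] min2 by (simp add: minimal_cycle_def)
  note d3 = this[THEN minimal_cycle_rotate, THEN minimal_cycle_rotate]
  note d4 = d3[THEN minimal_cycle_rotate]
  note d5 = d4[THEN minimal_cycle_rotate]
  \<comment> \<open>In this order, these bound the entries \<open>34\<close>, \<open>12\<close>,
    \<open>24\<close>, \<open>13\<close> and \<open>23\<close> from above. The first two come from
    the first cycle, the others from the second.\<close>
  note opt = two_opt[OF c3] two_opt[OF c4] two_opt[OF d3] two_opt[OF d4] two_opt[OF d5]
  have comm: "M {a4, a1} = M {a1, a4}" "M {a5, a1} = M {a1, a5}" "M {a5, a2} = M {a2, a5}"
    "M {a5, a3} = M {a3, a5}" "M {a3, a2} = M {a2, a3}"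
    by (simp_all add: insert_commute)
  note opt = opt[unfolded comm]
  \<comment> \<open>\<open>u1\<close>, \<open>u2\<close>, \<open>u3\<close> solve the three
    equations of the triangle \<open>a1a2a3\<close>, and \<open>u4\<close> is read off from
    \<open>24\<close>; the entry \<open>34\<close> is then matched by \<open>eq\<close>.\<close>
  define u1 where "u1 = (M {a1, a2} + M {a1, a3} - M {a2, a3}) / 2"
  define u2 where "u2 = M {a1, a2} - u1"
  define u3 where "u3 = M {a1, a3} - u1"
  define u4 where "u4 = M {a2, a4} - u2"
  \<comment> \<open>Only domination is wanted at \<open>a5\<close>, since the second tree realises
    all four entries there; \<open>u5\<close> is the least value that achieves it.\<close>
  define u5 where "u5 = Max {M {a1, a5} - u1, M {a2, a5} - u2, M {a3, a5} - u3, M {a4, a5} - u4}"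
  \<comment> \<open>Likewise \<open>v1\<close>, \<open>v4\<close>, \<open>v5\<close> solve the
    triangle \<open>a1a4a5\<close>, and \<open>v2\<close>, \<open>v3\<close> are read off from
    \<open>25\<close> and \<open>35\<close>.\<close>
  define v1 where "v1 = (M {a1, a4} + M {a1, a5} - M {a4, a5}) / 2"
  define v4 where "v4 = M {a1, a4} - v1"
  define v5 where "v5 = M {a1, a5} - v1"
  define v2 where "v2 = M {a2, a5} - v5"
  define v3 where "v3 = M {a3, a5} - v5"
  note u = u1_def u2_def u3_def u4_def and v = v1_def v2_def v3_def v4_def v5_def
  have u5: "M {a1, a5} \<le> u1 + u5" "M {a2, a5} \<le> u2 + u5" "M {a3, a5} \<le> u3 + u5"
    "M {a4, a5} \<le> u4 + u5"
    by (auto simp: u5_def)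
  have tight_u: "M {a1, a2} = u1 + u2" "M {a1, a3} = u1 + u3" "M {a2, a3} = u2 + u3"
    "M {a2, a4} = u2 + u4" "M {a3, a4} = u3 + u4"
    using eq by (simp_all add: u field_simps)
  have tight_v: "M {a1, a4} = v1 + v4" "M {a1, a5} = v1 + v5" "M {a4, a5} = v4 + v5"
    "M {a2, a5} = v2 + v5" "M {a3, a5} = v3 + v5"
    by (simp_all add: v field_simps)
  \<comment> \<open>\<open>u1 + u4\<close> equals the \<open>12|34\<close> sum minus
    \<open>M {a2, a3}\<close>, so this is \<open>le\<close> rearranged.\<close>
  have dom_u: "M {a1, a4} \<le> u1 + u4"
    using tight_u le by linarith
  \<comment> \<open>The first four are single members of \<open>opt\<close>. For \<open>23\<close>,
    the last member gives a bound through \<open>M {a1, a2}\<close>, which is in turn at most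
    \<open>v1 + v2\<close>.\<close>
  have dom_v: "M {a1, a2} \<le> v1 + v2" "M {a1, a3} \<le> v1 + v3" "M {a2, a4} \<le> v2 + v4"
    "M {a3, a4} \<le> v3 + v4" "M {a2, a3} \<le> v2 + v3"
    using tight_v opt by linarith+
  \<comment> \<open>Each of the ten entries is exact in one tree and dominated by the other.\<close>
  have entries: "M {a1, a2} = min (u1 + u2) (v1 + v2)" "M {a1, a3} = min (u1 + u3) (v1 + v3)"
    "M {a1, a4} = min (u1 + u4) (v1 + v4)" "M {a1, a5} = min (u1 + u5) (v1 + v5)"
    "M {a2, a3} = min (u2 + u3) (v2 + v3)" "M {a2, a4} = min (u2 + u4) (v2 + v4)"
    "M {a2, a5} = min (u2 + u5) (v2 + v5)" "M {a3, a4} = min (u3 + u4) (v3 + v4)"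
    "M {a3, a5} = min (u3 + u5) (v3 + v5)" "M {a4, a5} = min (u4 + u5) (v4 + v5)"
    using dom_u dom_v u5 by (simp_all flip: tight_u tight_v)
  define u where "u = (\<lambda>_. 0)(a1 := u1, a2 := u2, a3 := u3, a4 := u4, a5 := u5)"
  define v where "v = (\<lambda>_. 0)(a1 := v1, a2 := v2, a3 := v3, a4 := v4, a5 := v5)"
  have d: "distinct [a1, a2, a3, a4, a5]" and five: "{1..5} = {a1, a2, a3, a4, a5}"
    using a by (simp_all add: enumerates5_def)
  have vals: "u a1 = u1" "u a2 = u2" "u a3 = u3" "u a4 = u4" "u a5 = u5"
    "v a1 = v1" "v a2 = v2" "v a3 = v3" "v a4 = v4" "v a5 = v5"
    using d by (simp_all add: u_def v_def)
  show ?thesis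
  proof (rule is_min_of_star_trees_2I)
    fix i j :: nat
    assume "i \<in> {1..5}" "j \<in> {1..5}" "i \<noteq> j"
    then show "M {i, j} = min (u i + u j) (v i + v j)"
      unfolding five
      by (elim insertE emptyE) (simp_all add: vals entries insert_commute add.commute)
  qed
qed

text \<open>The rank itself is attained and gives a colouring with that many colours, so smaller
  ranks are covered by monotonicity of colourability. The converse passes through tied minimal
  cycles to a minimum of exactly two trees, which bounds the least \<open>r\<close>.\<close>

lemma star_tree_rank_le_2_iff: "star_tree_rank M \<le> 2 \<longleftrightarrow> colorable 2 (deficiency_graph M)"
proof
  have "is_min_of_star_trees M (star_tree_rank M)"
    unfolding star_tree_rank_def using ex_min_of_star_trees by (rule LeastI_ex)
  then show "star_tree_rank M \<le> 2 \<Longrightarrow> colorable 2 (deficiency_graph M)"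
    by (blast intro: colorable_mono is_min_of_star_trees_imp_colorable)
next
  assume "colorable 2 (deficiency_graph M)"
  then show "star_tree_rank M \<le> 2"
    unfolding star_tree_rank_def
    by (blast intro: Least_le tied_minimal_cycles_imp_is_min_of_star_trees
        dest: colorable_imp_tied_minimal_cycles)
qed

theorem theorem7p1:
  fixes M :: "nat set \<Rightarrow> real"
  shows "(star_tree_rank M \<le> 2 \<longleftrightarrow> colorable 2 (deficiency_graph M)) \<and>
    (colorable 2 (deficiency_graph M) \<longleftrightarrow>
      (\<exists>a. a permutes {1..5} \<and>
         attains_min_weight M (cycle5 (a 1) (a 2) (a 3) (a 4) (a 5)) \<and>
         attains_min_weight M (cycle5 (a 1) (a 3) (a 2) (a 4) (a 5)) \<and>
         M {a 1, a 4} + M {a 2, a 3} \<le> M {a 1, a 2} + M {a 3, a 4} \<and>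
         M {a 1, a 2} + M {a 3, a 4} = M {a 1, a 3} + M {a 2, a 4}))"
proof -
  have "colorable 2 (deficiency_graph M) \<longleftrightarrow>
      (\<exists>a1 a2 a3 a4 a5. tied_minimal_cycles M a1 a2 a3 a4 a5)"
    by (blast intro: is_min_of_star_trees_imp_colorable
        tied_minimal_cycles_imp_is_min_of_star_trees dest: colorable_imp_tied_minimal_cycles)
  then show ?thesis
    unfolding tied_minimal_cycles_def
    by (subst ex_permutes_iff_ex_enumerates5) (simp add: star_tree_rank_le_2_iff)
qed

end
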